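(* Consider a constrained multi-armed bandit with finite arm set $A$, and assume that the reward and the cost distributions associated with all arms in $A$ have support in $[0,1]$. Then for any $\epsilon>0$ and any integer $T\geq 2|A|$, the sets $A_T^*(\epsilon)$ and $A_T^f(\epsilon)$ obtained by running the CAPT algorithm (with parameter $\epsilon$) up to horizon $T$ satisfy $$\Pr\left\{ A^{\epsilon}_* \cap A^{-\epsilon}_f \subseteq A_T^*(\epsilon)\cap A_T^f(\epsilon) \subseteq A^{-\epsilon}_* \cap A^{\epsilon}_f \right\} \geq 1 - 2|A|\,T\, \exp\left(-\frac{T}{16\,H(\epsilon)}\right).$$
   Context: **Constrained multi-armed bandit.** $A$ is a finite set of arms with $|A|\geq 2$. At each discrete time $t\geq 1$ a single arm is played. If arm $a\in A$ is played at time $t$, the player observes a random reward $X_{a,t}\in\mathbb{R}$ and a random cost $Y_{a,t}\in\mathbb{R}$. For each fixed $a$, the variables $X_{a,t}$, $t\geq 1$, are identically distributed with mean $\mu_a$ and finite variance (the reward distribution of $a$), and the variables $Y_{a,t}$, $t\geq 1$, are identically distributed with mean $C_a$ and finite variance (the cost distribution of $a$). All rewards and costs, across all arms and all times, are independent. A constant $C\in\mathbb{R}$ is given and known to the player. The feasible set is $A_f:=\{a\in A \mid C_a\leq C\}$, assumed nonempty, and the optimal value is $\mu^*:=\max_{a\in A_f}\mu_a$. The value $\mu^*$ is assumed known to the algorithm. **Approximate sets.** For $\kappa\in\mathbb{R}$, $A_f^{\kappa}:=\{a\in A\mid C_a\leq C+\kappa\}$ and $A_*^{\kappa}:=\{a\in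 A\mid \mu_a\geq \mu^*+\kappa\}$. **Complexity.** For $a\in A$, $\Delta_a^{\epsilon}:=|\mu_a-\mu^*|+\epsilon$, $\Phi_a^{\epsilon}:=|C_a-C|+\epsilon$, and $H(\epsilon):=\sum_{a\in A}\min(\Delta_a^{\epsilon},\Phi_a^{\epsilon})^{-2}$. **CAPT algorithm with parameter $\epsilon$ and horizon $T$.** Let $I_n\in A$ denote the arm played at time $n$, and let $T_a(t):=\sum_{n=1}^{t}[I_n=a]$ be the number of plays of $a$ up to and including time $t$, where $[\cdot]$ is the indicator function. When $T_a(t)\geq 1$, define the sample means $$\bar X_{T_a(t)}:=\frac{1}{T_a(t)}\sum_{n=1}^{t}X_{a,n}[I_n=a],\qquad \bar Y_{T_a(t)}:=\frac{1}{T_a(t)}\sum_{n=1}^{t}Y_{a,n}[I_n=a]$$ (both are $0$ if $T_a(t)=0$), and set $\bar\Delta_a^{\epsilon}(t):=|\bar X_{T_a(t)}-\mu^*|+\epsilon$ and $\bar\Phi_a^{\epsilon}(t):=|\bar Y_{T_a(t)}-C|+\epsilon$. 1. Initialization: during times $t=1,\dots,|A|$, play each arm of $A$ exactly once, observing its reward and cost. 2. For each $t=|A|+1,\dots,T$: play an arm $$I_t\in\arg\min_{a\in A}\left(\min\left(\bar\Delta_a^{\epsilon}(t-1),\bar\Phi_a^{\epsilon}(t-1)\right)\sqrt{T_a(t-1)}\right),$$ and observe $X_{I_t,t}$ and $Y_{I_t,t}$. The arm chosen is a deterministic function of the past plays, rewards and costs. 3. Output: set $A_T^f(\epsilon):=\{a\in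 A\mid \bar Y_{T_a(T)}\leq C\}$ and $A_T^*(\epsilon):=\{a\in A\mid \bar X_{T_a(T)}\geq\mu^*\}$, and output $A_T^*(\epsilon)\cap A_T^f(\epsilon)$. *)

theory Defs
  imports "HOL-Probability.Probability"
begin

section \<open>The bandit model\<close>

definition feasible_set :: "'a set \<Rightarrow> ('a \<Rightarrow> real) \<Rightarrow> real \<Rightarrow> 'a set" where
  "feasible_set A c C = {a \<in> A. c a \<le> C}"

definition opt_value :: "'a set \<Rightarrow> ('a \<Rightarrow> real) \<Rightarrow> ('a \<Rightarrow> real) \<Rightarrow> real \<Rightarrow> real" where
  "opt_value A \<mu> c C = Max (\<mu> ` feasible_set A c C)"

text \<open>
  \<open>X a t\<close> and \<open>Y a t\<close> are the reward and the cost of arm \<open>a\<close> at time \<open>t \<ge> 1\<close> (the values at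
  time \<open>0\<close> are irrelevant). Independence is joint over all rewards and all costs, so \<open>X a t\<close> and
  \<open>Y a t\<close> are also independent of each other; the two families are indexed by a disjoint sum.
\<close>

locale constrained_bandit = prob_space M for M :: "'w measure" +
  fixes A :: "'a set"
    and X Y :: "'a \<Rightarrow> nat \<Rightarrow> 'w \<Rightarrow> real"
    and \<mu> c :: "'a \<Rightarrow> real"
    and C :: real
  assumes finite_arms: "finite A"
    and card_arms: "card A \<ge> 2"
    and reward_rv: "\<And>a t. a \<in> A \<Longrightarrow> t \<ge> 1 \<Longrightarrow> random_variable borel (X a t)"
    and cost_rv: "\<And>a t. a \<in> A \<Longrightarrow> t \<ge> 1 \<Longrightarrow> random_variable borel (Y a t)"
    and reward_ident: "\<And>a t. a \<in> A \<Longrightarrow> t \<ge> 1 \<Longrightarrow> distr M borel (X a t) = distr M borel (X a 1)"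
    and cost_ident: "\<And>a t. a \<in> A \<Longrightarrow> t \<ge> 1 \<Longrightarrow> distr M borel (Y a t) = distr M borel (Y a 1)"
    and reward_sq: "\<And>a t. a \<in> A \<Longrightarrow> t \<ge> 1 \<Longrightarrow> integrable M (\<lambda>\<omega>. (X a t \<omega>)\<^sup>2)"
    and cost_sq: "\<And>a t. a \<in> A \<Longrightarrow> t \<ge> 1 \<Longrightarrow> integrable M (\<lambda>\<omega>. (Y a t \<omega>)\<^sup>2)"
    and reward_mean: "\<And>a t. a \<in> A \<Longrightarrow> t \<ge> 1 \<Longrightarrow> expectation (X a t) = \<mu> a"
    and cost_mean: "\<And>a t. a \<in> A \<Longrightarrow> t \<ge> 1 \<Longrightarrow> expectation (Y a t) = c a"
    and indep: "indep_vars (\<lambda>_. borel) (case_sum (\<lambda>(a, t). X a t) (\<lambda>(a, t). Y a t))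
                  ((A \<times> {1..}) <+> (A \<times> {1..}))"
    and feasible_nonempty: "feasible_set A c C \<noteq> {}"

definition approx_feasible :: "'a set \<Rightarrow> ('a \<Rightarrow> real) \<Rightarrow> real \<Rightarrow> real \<Rightarrow> 'a set" where
  "approx_feasible A c C \<kappa> = {a \<in> A. c a \<le> C + \<kappa>}"

definition approx_optimal :: "'a set \<Rightarrow> ('a \<Rightarrow> real) \<Rightarrow> real \<Rightarrow> real \<Rightarrow> 'a set" where
  "approx_optimal A \<mu> \<mu>s \<kappa> = {a \<in> A. \<mu> a \<ge> \<mu>s + \<kappa>}"

definition complexity ::
    "'a set \<Rightarrow> ('a \<Rightarrow> real) \<Rightarrow> ('a \<Rightarrow> real) \<Rightarrow> real \<Rightarrow> real \<Rightarrow> real \<Rightarrow> real" where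
  "complexity A \<mu> c \<mu>s C \<epsilon> =
     (\<Sum>a\<in>A. 1 / (min (\<bar>\<mu> a - \<mu>s\<bar> + \<epsilon>) (\<bar>c a - C\<bar> + \<epsilon>))\<^sup>2)"

section \<open>The CAPT algorithm\<close>

text \<open>
  The next definitions concern one sample path: \<open>i n\<close> is the arm played at time \<open>n\<close>, and \<open>x a n\<close>,
  \<open>y a n\<close> are the realised rewards and costs.
\<close>

definition plays :: "(nat \<Rightarrow> 'a) \<Rightarrow> 'a \<Rightarrow> nat \<Rightarrow> nat" where
  "plays i a t = (\<Sum>n=1..t. of_bool (i n = a))"

text \<open>An arm that has not been played has sample mean \<open>0\<close>, since \<open>z / 0 = 0\<close>.\<close>

definition sample_mean :: "(nat \<Rightarrow> 'a) \<Rightarrow> ('a \<Rightarrow> nat \<Rightarrow> real) \<Rightarrow> 'a \<Rightarrow> nat \<Rightarrow> real" where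
  "sample_mean i z a t = (\<Sum>n=1..t. z a n * of_bool (i n = a)) / real (plays i a t)"

definition capt_index ::
    "real \<Rightarrow> real \<Rightarrow> real \<Rightarrow> (nat \<Rightarrow> 'a) \<Rightarrow> ('a \<Rightarrow> nat \<Rightarrow> real) \<Rightarrow> ('a \<Rightarrow> nat \<Rightarrow> real)
      \<Rightarrow> nat \<Rightarrow> 'a \<Rightarrow> real" where
  "capt_index \<mu>s C \<epsilon> i x y t a =
     min (\<bar>sample_mean i x a t - \<mu>s\<bar> + \<epsilon>) (\<bar>sample_mean i y a t - C\<bar> + \<epsilon>) * sqrt (real (plays i a t))"

definition capt_path ::
    "'a set \<Rightarrow> real \<Rightarrow> real \<Rightarrow> real \<Rightarrow> nat \<Rightarrow> (nat \<Rightarrow> 'a) \<Rightarrow> ('a \<Rightarrow> nat \<Rightarrow> real) \<Rightarrow> ('a \<Rightarrow> nat \<Rightarrow> real)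
      \<Rightarrow> bool" where
  "capt_path A \<mu>s C \<epsilon> T i x y \<longleftrightarrow>
     bij_betw i {1..card A} A \<and>
     (\<forall>t\<in>{card A + 1..T}. is_arg_min (capt_index \<mu>s C \<epsilon> i x y (t - 1)) (\<lambda>a. a \<in> A) (i t))"

definition output_optimal ::
    "'a set \<Rightarrow> real \<Rightarrow> nat \<Rightarrow> (nat \<Rightarrow> 'a) \<Rightarrow> ('a \<Rightarrow> nat \<Rightarrow> real) \<Rightarrow> 'a set" where
  "output_optimal A \<mu>s T i x = {a \<in> A. sample_mean i x a T \<ge> \<mu>s}"

definition output_feasible ::
    "'a set \<Rightarrow> real \<Rightarrow> nat \<Rightarrow> (nat \<Rightarrow> 'a) \<Rightarrow> ('a \<Rightarrow> nat \<Rightarrow> real) \<Rightarrow> 'a set" where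
  "output_feasible A C T i y = {a \<in> A. sample_mean i y a T \<le> C}"

text \<open>The plays, rewards and costs observed strictly before time \<open>t\<close>.\<close>

definition history ::
    "(nat \<Rightarrow> 'a) \<Rightarrow> ('a \<Rightarrow> nat \<Rightarrow> real) \<Rightarrow> ('a \<Rightarrow> nat \<Rightarrow> real) \<Rightarrow> nat \<Rightarrow> nat \<Rightarrow> 'a \<times> real \<times> real" where
  "history i x y t = (\<lambda>s\<in>{1..<t}. (i s, x (i s) s, y (i s) s))"

text \<open>
  \<open>I t \<omega>\<close> is the arm played at time \<open>t\<close>. The order of the initial plays and the breaking of ties
  are arbitrary, as long as each play is a deterministic function \<open>\<pi> t\<close> of the history. That
  function is required to be measurable, so that the plays are random variables.
\<close>

definition capt_run ::
    "'w measure \<Rightarrow> 'a set \<Rightarrow> ('a \<Rightarrow> nat \<Rightarrow> 'w \<Rightarrow> real) \<Rightarrow> ('a \<Rightarrow> nat \<Rightarrow> 'w \<Rightarrow> real)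
      \<Rightarrow> real \<Rightarrow> real \<Rightarrow> real \<Rightarrow> nat \<Rightarrow> (nat \<Rightarrow> 'w \<Rightarrow> 'a) \<Rightarrow> bool" where
  "capt_run M A X Y \<mu>s C \<epsilon> T I \<longleftrightarrow>
     (\<forall>\<omega>\<in>space M. capt_path A \<mu>s C \<epsilon> T (\<lambda>n. I n \<omega>) (\<lambda>a n. X a n \<omega>) (\<lambda>a n. Y a n \<omega>)) \<and>
     (\<exists>\<pi>. \<forall>t\<in>{1..T}.
        \<pi> t \<in> measurable (\<Pi>\<^sub>M s\<in>{1..<t}. count_space A \<Otimes>\<^sub>M (borel \<Otimes>\<^sub>M borel)) (count_space A) \<and>
        (\<forall>\<omega>\<in>space M.
           I t \<omega> = \<pi> t (history (\<lambda>n. I n \<omega>) (\<lambda>a n. X a n \<omega>) (\<lambda>a n. Y a n \<omega>) t)))"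

end

theory Submission
  imports Defs
begin

text \<open>
  The set \<open>approx_optimal A \<mu> \<mu>s \<epsilon> \<inter> approx_feasible A c C (- \<epsilon>)\<close> is empty because \<open>\<mu>s\<close> is the
  optimum, so only the second inclusion matters. Put \<open>\<theta> = sqrt (T / (32 H))\<close> and call a sample
  mean over \<open>s\<close> plays good if it errs by at most \<open>\<theta> / sqrt s\<close>. As \<open>T \<ge> 2 * card A\<close>, some arm \<open>a\<close>
  with gap \<open>D\<close> is played more than \<open>p = \<lceil>16 \<theta>\<^sup>2 / D\<^sup>2\<rceil>\<close> times. At its play number \<open>p + 1\<close> its index is
  at least \<open>4 \<theta> - \<theta>\<close> and minimal, which forces \<open>D b * sqrt s \<ge> 2 \<theta>\<close> for every arm \<open>b\<close>
  with \<open>s\<close> plays. Then the final sample mean that belongs to a constraint violated by more than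
  \<open>\<epsilon>\<close> errs by at most \<open>D b / 2\<close>, too little to hide the violation.

  The factor \<open>2\<close> of the bound leaves room for \<open>2 T\<close> tail events per arm, whereas two-sided control
  of both means for all \<open>s\<close> would take \<open>4 T\<close>. It suffices to control, for each \<open>s < T\<close>, one of the
  two means from both sides, and at \<open>s = p\<close> both means from one side. The sampling being adaptive,
  each tail event is estimated with an exponential supermartingale.
\<close>

section \<open>Exponential moments and concentration under predictable selection\<close>

lemma (in prob_space) indep_var_nn_integral_mult:
  fixes U V :: "'a \<Rightarrow> ennreal"
  assumes "indep_var borel U borel V"
  shows "(\<integral>\<^sup>+\<omega>. U \<omega> * V \<omega> \<partial>M) = (\<integral>\<^sup>+\<omega>. U \<omega> \<partial>M) * (\<integral>\<^sup>+\<omega>. V \<omega> \<partial>M)"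
proof -
  have "indep_vars (\<lambda>_. borel) (case_bool U V) UNIV"
    using assms unfolding indep_var_def
    by (rule indep_vars_cong[THEN iffD1, rotated -1]) (auto split: bool.splits)
  from indep_vars_nn_integral[OF _ this] show ?thesis
    by (simp add: UNIV_bool mult.commute)
qed

text \<open>Hoeffding's lemma for \<open>l\<close> of either sign: the negative case is the positive
  one for \<open>- Z\<close>. Both signs are needed for deviations to both sides.\<close>

lemma (in prob_space) nn_integral_exp_centered_le:
  fixes Z :: "'a \<Rightarrow> real"
  assumes "random_variable borel Z" and "AE \<omega> in M. Z \<omega> \<in> {0..1}"
  shows "(\<integral>\<^sup>+\<omega>. exp (l * (Z \<omega> - expectation Z)) \<partial>M) \<le> exp (l\<^sup>2 / 8)"
proof -
  interpret Z: interval_bounded_random_variable M Z 0 1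
    by unfold_locales (use assms in auto)
  interpret Z': interval_bounded_random_variable M "\<lambda>\<omega>. - Z \<omega>" "- 1" 0
    by unfold_locales (use assms in auto)
  consider "l > 0" | "l < 0" | "l = 0" by linarith
  then show ?thesis
  proof cases
    case 1
    then show ?thesis using Z.Hoeffdings_lemma_nn_integral[of l] by simp
  next
    case 2
    then show ?thesis using Z'.Hoeffdings_lemma_nn_integral[of "- l"] by (simp add: algebra_simps)
  next
    case 3
    then show ?thesis by (simp add: emeasure_space_1)
  qed
qed

text \<open>The exponential supermartingale of a predictable selection: the indicator \<open>B n\<close> is known
  before \<open>Z n\<close> is revealed, so a selected term has conditional expectation at most \<open>1\<close>.\<close>

lemma (in prob_space) nn_integral_exp_predictable_sum_le:
  fixes Z :: "nat \<Rightarrow> 'a \<Rightarrow> real" and B :: "nat \<Rightarrow> 'a \<Rightarrow> bool" and F :: "nat \<Rightarrow> 'a measure"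
  assumes subalg: "\<And>n. n < T \<Longrightarrow> subalgebra M (F n)"
    and indep: "\<And>n U. n < T \<Longrightarrow> U \<in> borel_measurable (F n) \<Longrightarrow> indep_var borel U borel (Z (Suc n))"
    and Z_meas: "\<And>n k. 1 \<le> n \<Longrightarrow> n \<le> k \<Longrightarrow> k < T \<Longrightarrow> Z n \<in> borel_measurable (F k)"
    and B_meas: "\<And>n k. 1 \<le> n \<Longrightarrow> n \<le> Suc k \<Longrightarrow> k < T \<Longrightarrow> Measurable.pred (F k) (B n)"
    and bound: "\<And>n. 1 \<le> n \<Longrightarrow> n \<le> T \<Longrightarrow> AE \<omega> in M. Z n \<omega> \<in> {0..1}"
    and mean: "\<And>n. 1 \<le> n \<Longrightarrow> n \<le> T \<Longrightarrow> expectation (Z n) = m"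
  shows "t \<le> T \<Longrightarrow>
    (\<integral>\<^sup>+\<omega>. exp (\<Sum>n=1..t. (l * (Z n \<omega> - m) - l\<^sup>2 / 8) * of_bool (B n \<omega>)) \<partial>M) \<le> 1"
proof (induction t)
  case 0
  then show ?case by (simp add: emeasure_space_1)
next
  case (Suc t)
  \<comment> \<open>If \<open>B (Suc t)\<close> fails, the exponential is \<open>W\<close>;
    otherwise it is \<open>U * V\<close> with \<open>U\<close> known at time \<open>t\<close>.
    Independence splits off \<open>V\<close>, whose mean is at most 1, and the two cases add up to
    \<open>W\<close> again.\<close>
  define W where "W \<omega> = exp (\<Sum>n=1..t. (l * (Z n \<omega> - m) - l\<^sup>2 / 8) * of_bool (B n \<omega>))" for \<omega>
  define U where "U \<omega> = W \<omega> * of_bool (B (Suc t) \<omega>)" for \<omega>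
  define V where "V \<omega> = exp (l * (Z (Suc t) \<omega> - m) - l\<^sup>2 / 8)" for \<omega>
  have t: "t < T" using Suc.prems by simp
  note lift = measurable_from_subalg[OF subalg[OF t]]
  \<comment> \<open>Independence from a constant carries the measurability of
    \<open>Z (Suc t)\<close> with it.\<close>
  have Zrv [measurable]: "random_variable borel (Z (Suc t))"
    using indep_var_rv2[OF indep[OF t, of "\<lambda>_. 0"]] by simp
  have [measurable]: "Measurable.pred (F t) (B (Suc t))" using B_meas t by simp
  have BM [measurable]: "Measurable.pred M (B (Suc t))"
    using lift[OF \<open>Measurable.pred (F t) (B (Suc t))\<close>] .
  have W_F [measurable]: "W \<in> borel_measurable (F t)"
  proof -
    have [measurable]: "Z n \<in> borel_measurable (F t)" "Measurable.pred (F t) (B n)"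
      if "n \<in> {1..t}" for n
      using that t Z_meas[of n t] B_meas[of n t] by auto
    show ?thesis unfolding W_def by measurable
  qed
  have U_F: "U \<in> borel_measurable (F t)" unfolding U_def by measurable
  have WM [measurable]: "W \<in> borel_measurable M" and UM [measurable]: "U \<in> borel_measurable M"
    using lift[OF W_F] lift[OF U_F] by simp_all
  have VM [measurable]: "V \<in> borel_measurable M" unfolding V_def using Zrv by measurable
  have "indep_var borel (ennreal \<circ> U) borel ((\<lambda>z. ennreal (exp (l * (z - m) - l\<^sup>2 / 8))) \<circ> Z (Suc t))"
    by (rule indep_var_compose[OF indep[OF t U_F]]) measurable
  then have indUV: "indep_var borel (\<lambda>\<omega>. ennreal (U \<omega>)) borel (\<lambda>\<omega>. ennreal (V \<omega>))"
    by (simp add: comp_def V_def)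
  have "(\<integral>\<^sup>+\<omega>. V \<omega> \<partial>M) = (\<integral>\<^sup>+\<omega>. ennreal (exp (- (l\<^sup>2 / 8))) * exp (l * (Z (Suc t) \<omega> - m)) \<partial>M)"
    unfolding V_def by (intro nn_integral_cong) (simp flip: ennreal_mult exp_add)
  also have "\<dots> = ennreal (exp (- (l\<^sup>2 / 8))) * (\<integral>\<^sup>+\<omega>. exp (l * (Z (Suc t) \<omega> - m)) \<partial>M)"
    by (rule nn_integral_cmult) measurable
  also have "\<dots> \<le> ennreal (exp (- (l\<^sup>2 / 8))) * exp (l\<^sup>2 / 8)"
    using nn_integral_exp_centered_le[OF Zrv bound[of "Suc t"], of l] mean[of "Suc t"] Suc.prems
    by (intro mult_left_mono) auto
  also have "\<dots> = 1" by (simp add: exp_minus flip: ennreal_mult)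
  finally have EV: "(\<integral>\<^sup>+\<omega>. V \<omega> \<partial>M) \<le> 1" .
  have "(\<integral>\<^sup>+\<omega>. exp (\<Sum>n=1..Suc t. (l * (Z n \<omega> - m) - l\<^sup>2 / 8) * of_bool (B n \<omega>)) \<partial>M)
      = (\<integral>\<^sup>+\<omega>. ennreal (W \<omega> * of_bool (\<not> B (Suc t) \<omega>)) + ennreal (U \<omega>) * ennreal (V \<omega>) \<partial>M)"
    by (intro nn_integral_cong) (auto simp: W_def U_def V_def exp_add ennreal_mult)
  also have "\<dots> = (\<integral>\<^sup>+\<omega>. ennreal (W \<omega> * of_bool (\<not> B (Suc t) \<omega>)) \<partial>M) + (\<integral>\<^sup>+\<omega>. ennreal (U \<omega>) * ennreal (V \<omega>) \<partial>M)"
    by (intro nn_integral_add) measurable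
  also have "(\<integral>\<^sup>+\<omega>. ennreal (U \<omega>) * ennreal (V \<omega>) \<partial>M) = (\<integral>\<^sup>+\<omega>. U \<omega> \<partial>M) * (\<integral>\<^sup>+\<omega>. V \<omega> \<partial>M)"
    by (rule indep_var_nn_integral_mult[OF indUV])
  also have "\<dots> \<le> (\<integral>\<^sup>+\<omega>. U \<omega> \<partial>M) * 1" by (intro mult_left_mono EV) simp
  also have "(\<integral>\<^sup>+\<omega>. ennreal (W \<omega> * of_bool (\<not> B (Suc t) \<omega>)) \<partial>M) + (\<integral>\<^sup>+\<omega>. U \<omega> \<partial>M) * 1
      = (\<integral>\<^sup>+\<omega>. ennreal (W \<omega> * of_bool (\<not> B (Suc t) \<omega>)) + ennreal (U \<omega>) \<partial>M)"
    by (simp, rule nn_integral_add[symmetric]) measurable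
  also have "\<dots> = (\<integral>\<^sup>+\<omega>. W \<omega> \<partial>M)"
    by (intro nn_integral_cong) (auto simp: U_def)
  also have "\<dots> \<le> 1" using Suc.IH t unfolding W_def by simp
  finally show ?case by (auto simp: add_left_mono)
qed

text \<open>Chernoff's method for the sum stopped after the \<open>s\<close>-th selection. At every
  time with exactly \<open>s\<close> selections this stopped sum is the same, so the quantifier over
  \<open>t\<close> costs no union bound.\<close>

lemma (in prob_space) predictable_Hoeffding:
  fixes Z :: "nat \<Rightarrow> 'a \<Rightarrow> real" and J :: "nat \<Rightarrow> 'a \<Rightarrow> bool" and F :: "nat \<Rightarrow> 'a measure"
  assumes subalg: "\<And>n. n < T \<Longrightarrow> subalgebra M (F n)"
    and indep: "\<And>n U. n < T \<Longrightarrow> U \<in> borel_measurable (F n) \<Longrightarrow> indep_var borel U borel (Z (Suc n))"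
    and Z_meas: "\<And>n k. 1 \<le> n \<Longrightarrow> n \<le> k \<Longrightarrow> k < T \<Longrightarrow> Z n \<in> borel_measurable (F k)"
    and J_meas: "\<And>n k. 1 \<le> n \<Longrightarrow> n \<le> Suc k \<Longrightarrow> k < T \<Longrightarrow> Measurable.pred (F k) (J n)"
    and bound: "\<And>n. 1 \<le> n \<Longrightarrow> n \<le> T \<Longrightarrow> AE \<omega> in M. Z n \<omega> \<in> {0..1}"
    and mean: "\<And>n. 1 \<le> n \<Longrightarrow> n \<le> T \<Longrightarrow> expectation (Z n) = m"
    and s: "s \<ge> 1" and x: "x \<ge> 0" and \<sigma>: "\<bar>\<sigma>\<bar> = 1"
  shows "prob {\<omega>\<in>space M. \<exists>t\<in>{1..T}. (\<Sum>n=1..t. of_bool (J n \<omega>)) = s \<and>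
      x \<le> \<sigma> * (\<Sum>n=1..t. (Z n \<omega> - m) * of_bool (J n \<omega>))} \<le> exp (- (2 * x\<^sup>2 / real s))"
    (is "prob ?E \<le> _")
proof -
  define N where "N t \<omega> = (\<Sum>n=1..t. of_bool (J n \<omega>) :: nat)" for t \<omega>
  \<comment> \<open>Only the first \<open>s\<close> selected terms are kept. The cap looks at times
    before \<open>n\<close>, so \<open>B\<close> is as predictable as \<open>J\<close>.\<close>
  define B where "B n \<omega> \<longleftrightarrow> J n \<omega> \<and> N (n - 1) \<omega> < s" for n \<omega>
  \<comment> \<open>The size \<open>4 * x / s\<close> maximises \<open>l * x - l^2 / 8 * s\<close>,
    with maximum \<open>2 * x^2 / s\<close>; the factor \<open>\<sigma>\<close> chooses the
    side.\<close>
  define l where "l = \<sigma> * (4 * x / s)"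
  define G where "G \<omega> = (\<Sum>n=1..T. (l * (Z n \<omega> - m) - l\<^sup>2 / 8) * of_bool (B n \<omega>))" for \<omega>
  have \<sigma>2: "\<sigma> * \<sigma> = 1" using \<sigma> by (cases "\<sigma> \<ge> 0") auto
  have l2: "l\<^sup>2 / 8 * s = 2 * x\<^sup>2 / s"
    using s by (simp add: l_def power2_eq_square \<sigma>2 field_simps)
  have ZM: "Z n \<in> borel_measurable M" if "n \<in> {1..T}" for n
    using indep_var_rv2[OF indep[of "n - 1" "\<lambda>_. 0"]] that by (cases n) auto
  have JM: "Measurable.pred M (J n)" if "n \<in> {1..T}" for n
    by (rule measurable_from_subalg[OF subalg[of "n - 1"]]) (use J_meas[of n "n - 1"] that in auto)
  have NF: "N t \<in> measurable (F k) (count_space UNIV)" if "t \<le> Suc k" "k < T" for t k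
  proof -
    have [measurable]: "Measurable.pred (F k) (J n)" if "n \<in> {1..t}" for n
      using J_meas[of n k] that \<open>t \<le> Suc k\<close> \<open>k < T\<close> by auto
    show ?thesis unfolding N_def by measurable
  qed
  have BF: "Measurable.pred (F k) (B n)" if "1 \<le> n" "n \<le> Suc k" "k < T" for n k
  proof -
    have [measurable]: "Measurable.pred (F k) (J n)" using J_meas that by blast
    have [measurable]: "N (n - 1) \<in> measurable (F k) (count_space UNIV)" using NF that by auto
    show ?thesis unfolding B_def by measurable
  qed
  have BM: "Measurable.pred M (B n)" if "n \<in> {1..T}" for n
    by (rule measurable_from_subalg[OF subalg[of "n - 1"]]) (use BF[of n "n - 1"] that in auto)
  have GM [measurable]: "G \<in> borel_measurable M"
  proof -
    have [measurable]: "Z n \<in> borel_measurable M" "Measurable.pred M (B n)" if "n \<in> {1..T}" for n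
      using that ZM BM by auto
    show ?thesis unfolding G_def by measurable
  qed
  have mgf: "(\<integral>\<^sup>+\<omega>. exp (G \<omega>) \<partial>M) \<le> 1"
    unfolding G_def by (rule nn_integral_exp_predictable_sum_le[of T F]) (use assms BF in auto)
  have N_Suc: "N (Suc t) \<omega> = N t \<omega> + of_bool (J (Suc t) \<omega>)" for t \<omega>
    by (simp add: N_def)
  have N_mono: "N t \<omega> \<le> N t' \<omega>" if "t \<le> t'" for t t' \<omega>
    unfolding N_def using that by (intro sum_mono2) auto
  have key: "2 * x\<^sup>2 / s \<le> G \<omega>"
    if t: "t \<in> {1..T}" and Nt: "N t \<omega> = s"
      and dev: "x \<le> \<sigma> * (\<Sum>n=1..t. (Z n \<omega> - m) * of_bool (J n \<omega>))" for \<omega> t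
  proof -
    \<comment> \<open>As the count is \<open>s\<close> at time \<open>t\<close>, every selection up
      to \<open>t\<close> is among the first \<open>s\<close>, and after \<open>t\<close> the cap
      blocks all others. Hence \<open>G\<close> is the exponent at time \<open>t\<close>.\<close>
    have 1: "B n \<omega> \<longleftrightarrow> n \<le> t \<and> J n \<omega>" if "n \<in> {1..T}" for n
    proof (cases "n \<le> t")
      case True
      then have "J n \<omega> \<Longrightarrow> N (n - 1) \<omega> < s"
        using N_Suc[of "n - 1" \<omega>] N_mono[of n t \<omega>] Nt that by auto
      then show ?thesis using True by (auto simp: B_def)
    next
      case False
      then have "N t \<omega> \<le> N (n - 1) \<omega>" by (intro N_mono) auto
      then show ?thesis using False Nt by (auto simp: B_def)
    qed
    have "G \<omega> = (\<Sum>n=1..T. if n \<le> t then (l * (Z n \<omega> - m) - l\<^sup>2 / 8) * of_bool (J n \<omega>) else 0)"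
      unfolding G_def by (intro sum.cong) (auto simp: 1)
    also have "\<dots> = (\<Sum>n=1..t. (l * (Z n \<omega> - m) - l\<^sup>2 / 8) * of_bool (J n \<omega>))"
      using t by (intro sum.mono_neutral_cong_right) auto
    also have "\<dots> = l * (\<Sum>n=1..t. (Z n \<omega> - m) * of_bool (J n \<omega>)) - l\<^sup>2 / 8 * real (N t \<omega>)"
      unfolding N_def of_nat_sum of_nat_of_bool sum_distrib_left
      by (simp only: left_diff_distrib sum_subtractf mult.assoc)
    finally have "G \<omega> = 4 * x / s * (\<sigma> * (\<Sum>n=1..t. (Z n \<omega> - m) * of_bool (J n \<omega>))) - 2 * x\<^sup>2 / s"
      using Nt l2 by (simp add: l_def)
    moreover have "4 * x / s * (\<sigma> * (\<Sum>n=1..t. (Z n \<omega> - m) * of_bool (J n \<omega>))) \<ge> 4 * x / s * x"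
      using dev x by (intro mult_left_mono) auto
    ultimately show ?thesis by (simp add: power2_eq_square)
  qed
  have "?E \<subseteq> {\<omega>\<in>space M. ennreal (exp (2 * x\<^sup>2 / s)) \<le> exp (G \<omega>)}"
    using key by (auto simp: N_def)
  then have "emeasure M ?E \<le> emeasure M {\<omega>\<in>space M. ennreal (exp (2 * x\<^sup>2 / s)) \<le> exp (G \<omega>)}"
    by (rule emeasure_mono) measurable
  \<comment> \<open>Division by the threshold gives the form \<open>1 \<le> c * u\<close> of
    Markov's inequality.\<close>
  also have "\<dots> \<le> emeasure M {\<omega>\<in>space M. 1 \<le> ennreal (exp (- (2 * x\<^sup>2 / s))) * ennreal (exp (G \<omega>))}"
  proof (rule emeasure_mono)
    show "{\<omega>\<in>space M. ennreal (exp (2 * x\<^sup>2 / s)) \<le> exp (G \<omega>)}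
        \<subseteq> {\<omega>\<in>space M. 1 \<le> ennreal (exp (- (2 * x\<^sup>2 / s))) * ennreal (exp (G \<omega>))}"
      by (auto simp flip: ennreal_mult exp_add)
  qed measurable
  also have "\<dots> \<le> ennreal (exp (- (2 * x\<^sup>2 / s))) * (\<integral>\<^sup>+\<omega>\<in>space M. exp (G \<omega>) \<partial>M)"
    by (rule nn_integral_Markov_inequality) auto
  also have "\<dots> \<le> ennreal (exp (- (2 * x\<^sup>2 / s))) * 1"
  proof (intro mult_left_mono)
    have "(\<integral>\<^sup>+\<omega>\<in>space M. exp (G \<omega>) \<partial>M) = (\<integral>\<^sup>+\<omega>. exp (G \<omega>) \<partial>M)"
      by (intro nn_integral_cong) auto
    with mgf show "(\<integral>\<^sup>+\<omega>\<in>space M. exp (G \<omega>) \<partial>M) \<le> 1" by simp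
  qed simp
  finally show ?thesis by (simp add: emeasure_eq_measure)
qed

section \<open>Counting plays along a sample path\<close>

lemma plays_Suc: "plays i a (Suc t) = plays i a t + of_bool (i (Suc t) = a)"
  by (simp add: plays_def)

lemma plays_mono: "t \<le> t' \<Longrightarrow> plays i a t \<le> plays i a t'"
  unfolding plays_def by (intro sum_mono2) auto

lemma sum_plays:
  assumes "finite A" and "\<And>n. n \<in> {1..t} \<Longrightarrow> i n \<in> A"
  shows "(\<Sum>a\<in>A. plays i a t) = t"
proof -
  have "(\<Sum>a\<in>A. plays i a t) = (\<Sum>n=1..t. \<Sum>a\<in>A. of_bool (i n = a))"
    unfolding plays_def by (rule sum.swap)
  also have "\<dots> = (\<Sum>n=1..t. 1)"
  proof (rule sum.cong)
    fix n assume "n \<in> {1..t}"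
    then have "A \<inter> {a. i n = a} = {i n}" using assms(2) by auto
    then show "(\<Sum>a\<in>A. of_bool (i n = a) :: nat) = 1" using assms(1) by (simp add: sum_of_bool_eq)
  qed simp
  finally show ?thesis by simp
qed

lemma plays_initial:
  assumes "bij_betw i {1..card A} A" and "a \<in> A"
  shows "plays i a (card A) = 1"
proof -
  obtain k where k: "k \<in> {1..card A}" "i k = a"
    using assms by (metis bij_betw_imp_surj_on imageE)
  then have "{1..card A} \<inter> {n. i n = a} = {k}"
    using inj_onD[OF bij_betw_imp_inj_on[OF assms(1)]] by fast
  then show ?thesis by (simp add: plays_def sum_of_bool_eq)
qed

text \<open>Translates between the sums of the concentration inequality and the error of a sample
  mean.\<close>

lemma sum_deviation_eq:
  assumes "plays i a t > 0"
  shows "(\<Sum>n=1..t. (z a n - m) * of_bool (i n = a)) = real (plays i a t) * (sample_mean i z a t - m)"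
proof -
  have "(\<Sum>n=1..t. (z a n - m) * of_bool (i n = a))
      = (\<Sum>n=1..t. z a n * of_bool (i n = a)) - m * real (plays i a t)"
    unfolding plays_def of_nat_sum of_nat_of_bool sum_distrib_left
    by (simp only: left_diff_distrib sum_subtractf mult.assoc)
  also have "\<dots> = real (plays i a t) * (sample_mean i z a t - m)"
    using assms by (simp add: sample_mean_def right_diff_distrib)
  finally show ?thesis .
qed

section \<open>Deterministic analysis of a single sample path\<close>

locale capt_instance =
  fixes A :: "'a set" and \<mu> c :: "'a \<Rightarrow> real" and \<mu>s C \<epsilon> :: real and T :: nat
  assumes finite_A: "finite A" and two_arms: "card A \<ge> 2"
    and horizon: "T \<ge> 2 * card A" and \<epsilon>_pos: "\<epsilon> > 0"
begin

abbreviation H :: real where "H \<equiv> complexity A \<mu> c \<mu>s C \<epsilon>"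

definition gap :: "'a \<Rightarrow> real" where
  "gap a = min (\<bar>\<mu> a - \<mu>s\<bar> + \<epsilon>) (\<bar>c a - C\<bar> + \<epsilon>)"

text \<open>Deviations are allowed up to \<open>radius / sqrt s\<close> after \<open>s\<close> plays; at this level Hoeffding's
  bound is \<open>exp (- T / (16 H))\<close> whatever \<open>s\<close> is.\<close>

definition radius :: real where
  "radius = sqrt (real T / (32 * H))"

text \<open>Since the plays add up to \<open>T\<close>, some arm is played more than \<open>pivot a\<close> times, and the play
  number \<open>pivot a + 1\<close> happens at an index of at least \<open>3 * radius\<close>.\<close>

definition pivot :: "'a \<Rightarrow> nat" where
  "pivot a = nat \<lceil>16 * radius\<^sup>2 / (gap a)\<^sup>2\<rceil>"

text \<open>The mean of only one of the two coordinates has to be controlled after \<open>s\<close> plays of \<open>a\<close>: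
  the smaller gap while \<open>a\<close> is underplayed, and afterwards a violated constraint.\<close>

definition reward_critical :: "'a \<Rightarrow> nat \<Rightarrow> bool" where
  "reward_critical a s \<longleftrightarrow>
     (if gap a * sqrt (real s) < 2 * radius then \<bar>\<mu> a - \<mu>s\<bar> \<le> \<bar>c a - C\<bar> else \<mu> a < \<mu>s - \<epsilon>)"

lemma gap_pos: "gap a > 0"
  using \<epsilon>_pos by (simp add: gap_def min_def add_nonneg_pos)

lemma A_nonempty: "A \<noteq> {}"
  using two_arms by auto

lemma H_eq: "H = (\<Sum>a\<in>A. 1 / (gap a)\<^sup>2)"
  by (simp add: complexity_def gap_def)

lemma H_pos: "H > 0"
  unfolding H_eq using gap_pos A_nonempty finite_A by (intro sum_pos) (auto simp: less_imp_neq[THEN not_sym])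

lemma T_pos: "T > 0"
  using two_arms horizon by linarith

lemma radius_pos: "radius > 0"
  using H_pos T_pos by (simp add: radius_def)

lemma radius_sq: "radius\<^sup>2 = real T / (32 * H)"
  using H_pos by (simp add: radius_def)

lemma pivot_pos: "pivot a \<ge> 1"
  using gap_pos[of a] radius_pos by (simp add: pivot_def Suc_le_eq)

lemma pivot_ge: "4 * radius \<le> gap a * sqrt (real (pivot a))"
proof -
  have "16 * radius\<^sup>2 / (gap a)\<^sup>2 \<le> real (pivot a)"
    unfolding pivot_def by (rule real_nat_ceiling_ge)
  then have "(4 * radius)\<^sup>2 \<le> (gap a * sqrt (real (pivot a)))\<^sup>2"
    using gap_pos[of a] by (simp add: field_simps power_mult_distrib)
  then show ?thesis
    by (rule power2_le_imp_le) (use gap_pos[of a] in simp)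
qed

lemma path_mem:
  assumes "capt_path A \<mu>s C \<epsilon> T i x y" and "n \<in> {1..T}"
  shows "i n \<in> A"
proof (cases "n \<le> card A")
  case True
  then show ?thesis using assms by (auto simp: capt_path_def bij_betw_def)
next
  case False
  then show ?thesis using assms by (auto simp: capt_path_def is_arg_min_def)
qed

text \<open>Initialization gives every arm a play, and as there is a second arm, none takes all
  \<open>T\<close>. So the union bound runs over \<open>T - 1\<close> counts, which leaves room for
  the events at the pivot.\<close>

lemma plays_bounds:
  assumes path: "capt_path A \<mu>s C \<epsilon> T i x y" and a: "a \<in> A" and t: "t \<in> {card A..T}"
  shows "plays i a t \<in> {1..<T}"
proof -
  have init: "plays i b (card A) = 1" if "b \<in> A" for b
    using path that plays_initial by (auto simp: capt_path_def)
  have ge: "plays i b s \<ge> 1" if "b \<in> A" "s \<ge> card A" for b s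
    using init[OF that(1)] plays_mono[OF that(2), of i b] by simp
  obtain b where b: "b \<in> A" "b \<noteq> a"
    using two_arms finite_A a
    by (metis One_nat_def card_le_Suc0_iff_eq not_less_eq_eq numeral_2_eq_2)
  have "plays i a T + plays i b T = (\<Sum>k\<in>{a, b}. plays i k T)" using b by simp
  also have "\<dots> \<le> (\<Sum>k\<in>A. plays i k T)"
    using a b finite_A by (intro sum_mono2) auto
  also have "\<dots> = T" by (rule sum_plays[OF finite_A]) (rule path_mem[OF path])
  finally have "plays i a T < T" using ge[OF b(1), of T] horizon by simp
  moreover have "plays i a t \<le> plays i a T" using t by (intro plays_mono) simp
  ultimately show ?thesis using ge[OF a, of t] t by simp
qed

text \<open>Pigeonhole: if no arm exceeded its pivot, summing the counts would give
  \<open>T - card A < 16 * radius^2 * H = T / 2\<close>, against the bound on the horizon.\<close>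

lemma pivot_reached:
  assumes path: "capt_path A \<mu>s C \<epsilon> T i x y"
  obtains a t where "t \<in> {card A..<T}" "i (Suc t) = a" "a \<in> A" "plays i a t = pivot a"
proof -
  have pl: "plays i a T \<ge> 1" if "a \<in> A" for a
    using plays_bounds[OF path that, of T] horizon by simp
  have "\<exists>a\<in>A. pivot a < plays i a T"
  proof (rule ccontr)
    assume neg: "\<not> ?thesis"
    have less: "real (plays i a T) - 1 < 16 * radius\<^sup>2 / (gap a)\<^sup>2" if "a \<in> A" for a
    proof -
      \<comment> \<open>An integer strictly below a ceiling is strictly below the number itself. The
        price of one play per arm adds up to \<open>card A\<close>.\<close>
      have "plays i a T - 1 < pivot a" using neg that pl[OF that] by force
      then have "int (plays i a T - 1) < \<lceil>16 * radius\<^sup>2 / (gap a)\<^sup>2\<rceil>"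
        by (simp add: pivot_def)
      then show ?thesis using pl[OF that] by (simp add: less_ceiling_iff of_nat_diff)
    qed
    have "real T - real (card A) = (\<Sum>a\<in>A. real (plays i a T) - 1)"
      using sum_plays[OF finite_A path_mem[OF path], of T]
      by (simp add: sum_subtractf flip: of_nat_sum)
    also have "\<dots> < (\<Sum>a\<in>A. 16 * radius\<^sup>2 / (gap a)\<^sup>2)"
      using finite_A A_nonempty less by (rule sum_strict_mono)
    also have "\<dots> = 16 * radius\<^sup>2 * H"
      by (simp add: H_eq sum_distrib_left)
    also have "\<dots> = real T / 2" using H_pos by (simp add: radius_sq)
    finally show False using horizon by simp
  qed
  then obtain a where a: "a \<in> A" "pivot a < plays i a T" by blast
  \<comment> \<open>At the first time the count exceeds the pivot, arm \<open>a\<close> has just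
    been played and its count before was exactly the pivot. As the pivot is at least 1, this happens
    after initialization, where the minimum rule applies.\<close>
  define t where "t = (LEAST t. pivot a < plays i a t)"
  have 1: "pivot a < plays i a t" unfolding t_def by (rule LeastI[of "\<lambda>t. pivot a < plays i a t", OF a(2)])
  have "t \<le> T" unfolding t_def by (rule Least_le[of "\<lambda>t. pivot a < plays i a t", OF a(2)])
  have "plays i a (card A) = 1" using path a(1) plays_initial by (auto simp: capt_path_def)
  then have "card A < t"
    using 1 pivot_pos[of a] plays_mono[of t "card A" i a] by (cases "t \<le> card A") auto
  then obtain t' where t': "t = Suc t'" by (cases t) auto
  have 2: "plays i a t' \<le> pivot a"
    using not_less_Least[of t' "\<lambda>t. pivot a < plays i a t"] t' by (simp add: t_def)
  have "i (Suc t') = a" "plays i a t' = pivot a"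
    using 1 2 by (cases "i (Suc t') = a"; simp add: t' plays_Suc)+
  then show thesis using that[of t' a] a(1) t' \<open>t \<le> T\<close> \<open>card A < t\<close> by auto
qed

text \<open>When the arm at its pivot is chosen, its index is at least \<open>3 * radius\<close>,
  hence so is every index. An arm \<open>b\<close> still below \<open>2 * radius\<close> would have
  an index below \<open>2 * radius + radius\<close>.\<close>

lemma enough_plays:
  assumes path: "capt_path A \<mu>s C \<epsilon> T i x y"
    and pivot_dev: "\<And>a t. a \<in> A \<Longrightarrow> t \<in> {1..T} \<Longrightarrow> plays i a t = pivot a \<Longrightarrow>
      (\<bar>\<mu> a - \<mu>s\<bar> - \<bar>sample_mean i x a t - \<mu>s\<bar>) * sqrt (real (pivot a)) \<le> radius \<and>
      (\<bar>c a - C\<bar> - \<bar>sample_mean i y a t - C\<bar>) * sqrt (real (pivot a)) \<le> radius"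
    and dev: "\<And>a t. a \<in> A \<Longrightarrow> t \<in> {1..T} \<Longrightarrow> plays i a t \<in> {1..<T} \<Longrightarrow>
      \<bar>if reward_critical a (plays i a t) then sample_mean i x a t - \<mu> a
        else sample_mean i y a t - c a\<bar> * sqrt (real (plays i a t)) \<le> radius"
    and b: "b \<in> A"
  shows "2 * radius \<le> gap b * sqrt (real (plays i b T))"
proof -
  obtain a t where t: "t \<in> {card A..<T}" and a: "i (Suc t) = a" "a \<in> A" "plays i a t = pivot a"
    using pivot_reached[OF path] .
  let ?ix = "capt_index \<mu>s C \<epsilon> i x y t"
  have tT: "t \<in> {1..T}" using t two_arms by auto
  have "is_arg_min ?ix (\<lambda>a. a \<in> A) a"
    using path t a(1) by (auto simp: capt_path_def dest!: bspec[of _ _ "Suc t"])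
  then have ab: "?ix a \<le> ?ix b" using b by (auto simp: is_arg_min_def not_less)
  have "4 * radius - radius \<le> ?ix a"
  proof -
    \<comment> \<open>Only a shrinking empirical gap lowers the index, so one-sided bounds suffice;
      both coordinates are needed because the index is a minimum.\<close>
    let ?r = "sqrt (real (pivot a))"
    have "gap a * ?r - radius \<le> (\<bar>sample_mean i x a t - \<mu>s\<bar> + \<epsilon>) * ?r"
    proof -
      have "gap a * ?r \<le> (\<bar>\<mu> a - \<mu>s\<bar> + \<epsilon>) * ?r" by (intro mult_right_mono) (auto simp: gap_def)
      then show ?thesis using pivot_dev[OF a(2) tT a(3)] by (simp add: algebra_simps)
    qed
    moreover have "gap a * ?r - radius \<le> (\<bar>sample_mean i y a t - C\<bar> + \<epsilon>) * ?r"
    proof -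
      have "gap a * ?r \<le> (\<bar>c a - C\<bar> + \<epsilon>) * ?r" by (intro mult_right_mono) (auto simp: gap_def)
      then show ?thesis using pivot_dev[OF a(2) tT a(3)] by (simp add: algebra_simps)
    qed
    ultimately show ?thesis using pivot_ge[of a] a(3) by (auto simp: capt_index_def min_def)
  qed
  then have ix: "3 * radius \<le> ?ix b" using ab by simp
  have "2 * radius \<le> gap b * sqrt (real (plays i b t))"
  proof (rule ccontr)
    assume neg: "\<not> ?thesis"
    let ?r = "sqrt (real (plays i b t))"
    have "plays i b t \<in> {1..<T}" using plays_bounds[OF path b, of t] t by simp
    \<comment> \<open>For an underplayed arm \<open>reward_critical\<close> picks the coordinate
      with the smaller true gap, and its empirical gap alone bounds the minimum from above.\<close>
    from dev[OF b tT this] have d: "\<bar>if \<bar>\<mu> b - \<mu>s\<bar> \<le> \<bar>c b - C\<bar> then sample_mean i x b t - \<mu> b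
        else sample_mean i y b t - c b\<bar> * ?r \<le> radius"
      using neg by (simp add: reward_critical_def)
    have "?ix b \<le> (gap b + \<bar>if \<bar>\<mu> b - \<mu>s\<bar> \<le> \<bar>c b - C\<bar> then sample_mean i x b t - \<mu> b
        else sample_mean i y b t - c b\<bar>) * ?r"
      unfolding capt_index_def gap_def by (intro mult_right_mono) (auto split: if_splits)
    also have "\<dots> < 3 * radius" using d neg by (simp add: distrib_right)
    finally show False using ix by simp
  qed
  also have "\<dots> \<le> gap b * sqrt (real (plays i b T))"
    using gap_pos[of b] t plays_mono[of t T i b] by (intro mult_left_mono) auto
  finally show ?thesis .
qed

lemma output_subset:
  assumes path: "capt_path A \<mu>s C \<epsilon> T i x y"
    and pivot_dev: "\<And>a t. a \<in> A \<Longrightarrow> t \<in> {1..T} \<Longrightarrow> plays i a t = pivot a \<Longrightarrow>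
      (\<bar>\<mu> a - \<mu>s\<bar> - \<bar>sample_mean i x a t - \<mu>s\<bar>) * sqrt (real (pivot a)) \<le> radius \<and>
      (\<bar>c a - C\<bar> - \<bar>sample_mean i y a t - C\<bar>) * sqrt (real (pivot a)) \<le> radius"
    and dev: "\<And>a t. a \<in> A \<Longrightarrow> t \<in> {1..T} \<Longrightarrow> plays i a t \<in> {1..<T} \<Longrightarrow>
      \<bar>if reward_critical a (plays i a t) then sample_mean i x a t - \<mu> a
        else sample_mean i y a t - c a\<bar> * sqrt (real (plays i a t)) \<le> radius"
  shows "output_optimal A \<mu>s T i x \<inter> output_feasible A C T i y
    \<subseteq> approx_optimal A \<mu> \<mu>s (- \<epsilon>) \<inter> approx_feasible A c C \<epsilon>"
proof
  fix b assume out: "b \<in> output_optimal A \<mu>s T i x \<inter> output_feasible A C T i y"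
  then have b: "b \<in> A" by (simp add: output_optimal_def)
  have x: "\<mu>s \<le> sample_mean i x b T" and y: "sample_mean i y b T \<le> C"
    using out by (auto simp: output_optimal_def output_feasible_def)
  let ?r = "sqrt (real (plays i b T))"
  have pl: "plays i b T \<in> {1..<T}" using plays_bounds[OF path b, of T] horizon by simp
  then have r: "?r > 0" by simp
  have enough: "2 * radius \<le> gap b * ?r"
    using enough_plays[OF path pivot_dev dev b] .
  have close: "2 * d \<le> gap b" if "d * ?r \<le> radius" for d
  proof -
    have "2 * d * ?r \<le> gap b * ?r" using that enough by simp
    then show ?thesis using r by simp
  qed
  have T: "T \<in> {1..T}" using T_pos by auto
  have "\<not> \<mu> b < \<mu>s - \<epsilon>"
  proof
    assume bad: "\<mu> b < \<mu>s - \<epsilon>"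
    then have "\<bar>sample_mean i x b T - \<mu> b\<bar> * ?r \<le> radius"
      using dev[OF b T pl] enough by (auto simp: reward_critical_def)
    \<comment> \<open>To hide the violation the error must reach
      \<open>\<bar>\<mu> b - \<mu>s\<bar>\<close>. Half of
      \<open>\<bar>\<mu> b - \<mu>s\<bar> + \<epsilon>\<close> is less, since the violation exceeds
      \<open>\<epsilon>\<close>.\<close>
    then have "2 * \<bar>sample_mean i x b T - \<mu> b\<bar> \<le> gap b" by (rule close)
    also have "\<dots> \<le> \<bar>\<mu> b - \<mu>s\<bar> + \<epsilon>" by (simp add: gap_def)
    finally show False using x bad \<epsilon>_pos abs_ge_self[of "sample_mean i x b T - \<mu> b"] by simp
  qed
  moreover have "\<not> C + \<epsilon> < c b"
  proof
    assume bad: "C + \<epsilon> < c b"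
    \<comment> \<open>With a reward violation excluded, \<open>reward_critical\<close> is false
      after enough plays, so here the cost mean is the controlled one.\<close>
    then have "\<bar>sample_mean i y b T - c b\<bar> * ?r \<le> radius"
      using dev[OF b T pl] enough \<open>\<not> \<mu> b < \<mu>s - \<epsilon>\<close> by (auto simp: reward_critical_def)
    then have "2 * \<bar>sample_mean i y b T - c b\<bar> \<le> gap b" by (rule close)
    also have "\<dots> \<le> \<bar>c b - C\<bar> + \<epsilon>" by (simp add: gap_def)
    finally show False using y bad \<epsilon>_pos abs_ge_minus_self[of "sample_mean i y b T - c b"] by simp
  qed
  ultimately show "b \<in> approx_optimal A \<mu> \<mu>s (- \<epsilon>) \<inter> approx_feasible A c C \<epsilon>"
    using b by (auto simp: approx_optimal_def approx_feasible_def)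
qed

end

section \<open>The filtration of rewards and costs\<close>

context constrained_bandit
begin

definition observable :: "'a \<times> nat + 'a \<times> nat \<Rightarrow> 'w \<Rightarrow> real" where
  "observable = case_sum (\<lambda>(a, t). X a t) (\<lambda>(a, t). Y a t)"

definition slots :: "nat \<Rightarrow> ('a \<times> nat + 'a \<times> nat) set" where
  "slots k = (A \<times> {1..k}) <+> (A \<times> {1..k})"

text \<open>The \<open>\<sigma>\<close>-algebra generated by all rewards and costs up to time \<open>k\<close>, including those that
  the player does not see.\<close>

definition past :: "nat \<Rightarrow> 'w measure" where
  "past k = vimage_algebra (space M) (\<lambda>\<omega>. \<lambda>j\<in>slots k. observable j \<omega>) (\<Pi>\<^sub>M j\<in>slots k. borel)"

lemma space_past [simp]: "space (past k) = space M"
  by (simp add: past_def)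

lemma indep_observable: "indep_vars (\<lambda>_. borel) observable ((A \<times> {1..}) <+> (A \<times> {1..}))"
  using indep by (simp add: observable_def)

lemma observable_rv: "j \<in> (A \<times> {1..}) <+> (A \<times> {1..}) \<Longrightarrow> random_variable borel (observable j)"
  using indep_observable unfolding indep_vars_def by blast

lemma slots_subset: "slots k \<subseteq> (A \<times> {1..}) <+> (A \<times> {1..})"
  by (auto simp: slots_def)

lemma restrict_observable_measurable:
  "(\<lambda>\<omega>. \<lambda>j\<in>slots k. observable j \<omega>) \<in> measurable M (\<Pi>\<^sub>M j\<in>slots k. borel)"
  using observable_rv slots_subset by (intro measurable_restrict) blast

lemma sets_past:
  "sets (past k) = {(\<lambda>\<omega>. \<lambda>j\<in>slots k. observable j \<omega>) -` B \<inter> space M | B. B \<in> sets (\<Pi>\<^sub>M j\<in>slots k. borel)}"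
  unfolding past_def
  by (rule sets_vimage_algebra2) (use measurable_space[OF restrict_observable_measurable] in blast)

lemma subalgebra_past: "subalgebra M (past k)"
  unfolding subalgebra_def sets_past
  using measurable_sets[OF restrict_observable_measurable] by auto

lemma observable_past_measurable:
  assumes "j \<in> slots k"
  shows "observable j \<in> borel_measurable (past k)"
proof -
  have "(\<lambda>\<omega>. \<lambda>j\<in>slots k. observable j \<omega>) \<in> measurable (past k) (\<Pi>\<^sub>M j\<in>slots k. borel)"
    unfolding past_def
    by (rule measurable_vimage_algebra1) (use measurable_space[OF restrict_observable_measurable] in blast)
  then have "(\<lambda>\<omega>. (\<lambda>j\<in>slots k. observable j \<omega>) j) \<in> borel_measurable (past k)"
    by (rule measurable_compose) (rule measurable_component_singleton[OF assms])
  with assms show ?thesis by simp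
qed

lemma reward_past_measurable: "a \<in> A \<Longrightarrow> n \<in> {1..k} \<Longrightarrow> X a n \<in> borel_measurable (past k)"
  using observable_past_measurable[of "Inl (a, n)" k] by (auto simp: slots_def observable_def Plus_def)

lemma cost_past_measurable: "a \<in> A \<Longrightarrow> n \<in> {1..k} \<Longrightarrow> Y a n \<in> borel_measurable (past k)"
  using observable_past_measurable[of "Inr (a, n)" k] by (auto simp: slots_def observable_def Plus_def)

text \<open>Disjoint groups of an independent family generate independent \<sigma>-algebras. That of
  \<open>U\<close> lies in the one of the group \<open>slots k\<close>, and that of
  \<open>observable j\<close> in the one of the group \<open>{j}\<close>.\<close>

lemma indep_past:
  assumes U: "U \<in> borel_measurable (past k)"
    and j: "j \<in> (A \<times> {1..}) <+> (A \<times> {1..})" "j \<notin> slots k"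
  shows "indep_var borel U borel (observable j)"
proof -
  let ?R = "\<lambda>K \<omega>. \<lambda>i\<in>K. observable i \<omega>"
  have "indep_var (PiM (slots k) (\<lambda>_. borel)) (?R (slots k)) (PiM {j} (\<lambda>_. borel)) (?R {j})"
    using j slots_subset by (intro indep_var_restrict[OF indep_observable]) auto
  then have ind: "indep_set
      (sigma_sets (space M) {?R (slots k) -` B \<inter> space M | B. B \<in> sets (PiM (slots k) (\<lambda>_. borel))})
      (sigma_sets (space M) {?R {j} -` B \<inter> space M | B. B \<in> sets (PiM {j} (\<lambda>_. borel))})"
    by (simp add: indep_var_eq)
  have 1: "{U -` B \<inter> space M | B. B \<in> sets borel}
      \<subseteq> {?R (slots k) -` B \<inter> space M | B. B \<in> sets (PiM (slots k) (\<lambda>_. borel))}"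
    using measurable_sets[OF U] unfolding sets_past[symmetric] by auto
  have 2: "{observable j -` B \<inter> space M | B. B \<in> sets borel}
      \<subseteq> {?R {j} -` B \<inter> space M | B. B \<in> sets (PiM {j} (\<lambda>_. borel))}"
  proof safe
    fix B :: "real set" assume B: "B \<in> sets borel"
    have "(\<lambda>f. f j) \<in> measurable (PiM {j} (\<lambda>_. borel)) (borel :: real measure)"
      by (rule measurable_component_singleton) simp
    then have "(\<lambda>f. f j) -` B \<inter> space (PiM {j} (\<lambda>_. borel)) \<in> sets (PiM {j} (\<lambda>_. borel))"
      using B by (rule measurable_sets)
    moreover have "observable j -` B \<inter> space M
        = ?R {j} -` ((\<lambda>f. f j) -` B \<inter> space (PiM {j} (\<lambda>_. borel))) \<inter> space M"
      by (auto simp: space_PiM)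
    ultimately show "\<exists>B'. observable j -` B \<inter> space M = ?R {j} -` B' \<inter> space M
        \<and> B' \<in> sets (PiM {j} (\<lambda>_. borel))" by blast
  qed
  have "indep_set (sigma_sets (space M) {U -` B \<inter> space M | B. B \<in> sets borel})
      (sigma_sets (space M) {observable j -` B \<inter> space M | B. B \<in> sets borel})"
    using ind unfolding indep_set_def
    by (rule indep_sets_mono_sets) (auto split: bool.split dest: subsetD[OF sigma_sets_mono'[OF 1]] subsetD[OF sigma_sets_mono'[OF 2]])
  then show ?thesis
    using measurable_from_subalg[OF subalgebra_past U] observable_rv[OF j(1)] by (simp add: indep_var_eq)
qed

end

section \<open>Tail events of the random run and the union bound\<close>

locale bounded_capt_run = constrained_bandit M A X Y \<mu> c C + capt_instance A \<mu> c \<mu>s C \<epsilon> T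
  for M :: "'w measure" and A :: "'a set" and X Y :: "'a \<Rightarrow> nat \<Rightarrow> 'w \<Rightarrow> real"
    and \<mu> c :: "'a \<Rightarrow> real" and C \<mu>s \<epsilon> :: real and T :: nat +
  fixes I :: "nat \<Rightarrow> 'w \<Rightarrow> 'a"
  assumes run: "capt_run M A X Y \<mu>s C \<epsilon> T I"
    and reward_bounded: "\<And>a t. a \<in> A \<Longrightarrow> t \<ge> 1 \<Longrightarrow> AE \<omega> in M. X a t \<omega> \<in> {0..1}"
    and cost_bounded: "\<And>a t. a \<in> A \<Longrightarrow> t \<ge> 1 \<Longrightarrow> AE \<omega> in M. Y a t \<omega> \<in> {0..1}"
begin

text \<open>Strong induction on time: the history before \<open>t\<close> consists of plays, rewards
  and costs at times at most \<open>k\<close>. Allowing \<open>t = Suc k\<close> expresses that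
  plays are predictable.\<close>

lemma play_past_measurable:
  "t \<in> {1..T} \<Longrightarrow> t \<le> Suc k \<Longrightarrow> I t \<in> measurable (past k) (count_space A)"
proof (induction t rule: less_induct)
  case (less t)
  obtain \<pi> where \<pi>: "\<And>t. t \<in> {1..T} \<Longrightarrow>
        \<pi> t \<in> measurable (\<Pi>\<^sub>M s\<in>{1..<t}. count_space A \<Otimes>\<^sub>M (borel \<Otimes>\<^sub>M borel)) (count_space A)"
      "\<And>t \<omega>. t \<in> {1..T} \<Longrightarrow> \<omega> \<in> space M \<Longrightarrow>
        I t \<omega> = \<pi> t (history (\<lambda>n. I n \<omega>) (\<lambda>a n. X a n \<omega>) (\<lambda>a n. Y a n \<omega>) t)"
    using run unfolding capt_run_def by blast
  have "(\<lambda>\<omega>. history (\<lambda>n. I n \<omega>) (\<lambda>a n. X a n \<omega>) (\<lambda>a n. Y a n \<omega>) t)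
      \<in> measurable (past k) (\<Pi>\<^sub>M s\<in>{1..<t}. count_space A \<Otimes>\<^sub>M (borel \<Otimes>\<^sub>M borel))"
    unfolding history_def
  proof (rule measurable_restrict)
    fix s assume s: "s \<in> {1..<t}"
    have Is: "I s \<in> measurable (past k) (count_space A)"
      using less.IH[of s] less.prems s by simp
    \<comment> \<open>The reward of a random arm is measurable because the arm takes only finitely
      many values.\<close>
    have "(\<lambda>\<omega>. X (I s \<omega>) s \<omega>) \<in> borel_measurable (past k)"
      using s less.prems finite_arms
      by (intro measurable_compose_countable'[OF _ Is, of "\<lambda>a. X a s"] reward_past_measurable)
        (auto intro: countable_finite)
    moreover have "(\<lambda>\<omega>. Y (I s \<omega>) s \<omega>) \<in> borel_measurable (past k)"
      using s less.prems finite_arms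
      by (intro measurable_compose_countable'[OF _ Is, of "\<lambda>a. Y a s"] cost_past_measurable)
        (auto intro: countable_finite)
    ultimately show "(\<lambda>\<omega>. (I s \<omega>, X (I s \<omega>) s \<omega>, Y (I s \<omega>) s \<omega>))
        \<in> measurable (past k) (count_space A \<Otimes>\<^sub>M (borel \<Otimes>\<^sub>M borel))"
      using Is by (intro measurable_Pair) auto
  qed
  from measurable_compose[OF this \<pi>(1)[OF less.prems(1)]] show ?case
    by (rule measurable_cong[THEN iffD1, rotated]) (simp add: \<pi>(2)[OF less.prems(1)])
qed

lemma play_eq_past_measurable:
  assumes "n \<in> {1..T}" and "n \<le> Suc k"
  shows "Measurable.pred (past k) (\<lambda>\<omega>. I n \<omega> = a)"
  by (rule measurable_compose[OF play_past_measurable[OF assms], of "\<lambda>b. b = a"]) simp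

lemma play_eq_measurable: "n \<in> {1..T} \<Longrightarrow> Measurable.pred M (\<lambda>\<omega>. I n \<omega> = a)"
  by (rule measurable_from_subalg[OF subalgebra_past play_eq_past_measurable[of n n]]) auto

lemma plays_measurable:
  assumes "t \<le> T"
  shows "(\<lambda>\<omega>. plays (\<lambda>n. I n \<omega>) a t) \<in> measurable M (count_space UNIV)"
proof -
  have [measurable]: "Measurable.pred M (\<lambda>\<omega>. I n \<omega> = a)" if "n \<in> {1..t}" for n
    using play_eq_measurable[of n] that assms by auto
  show ?thesis unfolding plays_def by measurable
qed

text \<open>The flag \<open>r\<close> is true for rewards and false for costs, so
  \<open>reward_critical a s\<close> can be passed for it.\<close>

definition empirical :: "bool \<Rightarrow> 'a \<Rightarrow> nat \<Rightarrow> 'w \<Rightarrow> real" where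
  "empirical r a t \<omega> =
     (if r then sample_mean (\<lambda>n. I n \<omega>) (\<lambda>a n. X a n \<omega>) a t
      else sample_mean (\<lambda>n. I n \<omega>) (\<lambda>a n. Y a n \<omega>) a t)"

definition true_mean :: "bool \<Rightarrow> 'a \<Rightarrow> real" where
  "true_mean r a = (if r then \<mu> a else c a)"

text \<open>The sign \<open>\<sigma>\<close> selects the side. A sample mean does not change between
  plays of its arm, so these events are indexed by the count \<open>s\<close> and not by
  time.\<close>

definition deviation :: "real \<Rightarrow> bool \<Rightarrow> 'a \<Rightarrow> nat \<Rightarrow> 'w set" where
  "deviation \<sigma> r a s = {\<omega>\<in>space M. \<exists>t\<in>{1..T}. plays (\<lambda>n. I n \<omega>) a t = s \<and>
     radius \<le> \<sigma> * (empirical r a t \<omega> - true_mean r a) * sqrt (real s)}"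

lemma empirical_measurable:
  assumes "a \<in> A" and "t \<le> T"
  shows "empirical r a t \<in> borel_measurable M"
proof -
  have [measurable]: "Measurable.pred M (\<lambda>\<omega>. I n \<omega> = a)" "X a n \<in> borel_measurable M"
      "Y a n \<in> borel_measurable M" if "n \<in> {1..t}" for n
    using play_eq_measurable[of n] reward_rv[of a n] cost_rv[of a n] that assms by auto
  have [measurable]: "(\<lambda>\<omega>. plays (\<lambda>n. I n \<omega>) a t) \<in> measurable M (count_space UNIV)"
    using plays_measurable assms(2) .
  show ?thesis unfolding empirical_def[abs_def] sample_mean_def by measurable
qed

lemma deviation_sets:
  assumes "a \<in> A"
  shows "deviation \<sigma> r a s \<in> events"
proof -
  have [measurable]: "empirical r a t \<in> borel_measurable M"
      "(\<lambda>\<omega>. plays (\<lambda>n. I n \<omega>) a t) \<in> measurable M (count_space UNIV)" if "t \<in> {1..T}" for t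
    using empirical_measurable[OF assms] plays_measurable that by auto
  show ?thesis unfolding deviation_def by measurable
qed

text \<open>An error \<open>radius / sqrt s\<close> of the mean is a deviation
  \<open>radius * sqrt s\<close> of the sum. Hoeffding's exponent is then
  \<open>2 * radius^2\<close>, whatever \<open>s\<close> is.\<close>

lemma prob_deviation_le:
  assumes a: "a \<in> A" and s: "s \<ge> 1" and \<sigma>: "\<bar>\<sigma>\<bar> = 1"
  shows "prob (deviation \<sigma> r a s) \<le> exp (- (real T / (16 * H)))"
proof -
  \<comment> \<open>The injection \<open>e\<close> sends the chosen kind to its side of the disjoint
    sum, so rewards and costs share one argument.\<close>
  define e :: "'a \<times> nat \<Rightarrow> 'a \<times> nat + 'a \<times> nat" where "e = (if r then Inl else Inr)"
  define Z where "Z n = observable (e (a, n))" for n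
  have Z: "Z n = (if r then X a n else Y a n)" for n
    by (simp add: Z_def e_def observable_def)
  have "deviation \<sigma> r a s = {\<omega>\<in>space M. \<exists>t\<in>{1..T}. (\<Sum>n=1..t. of_bool (I n \<omega> = a)) = s \<and>
      radius * sqrt (real s) \<le> \<sigma> * (\<Sum>n=1..t. (Z n \<omega> - true_mean r a) * of_bool (I n \<omega> = a))}"
    (is "_ = ?E")
  proof -
    have "radius \<le> \<sigma> * (empirical r a t \<omega> - true_mean r a) * sqrt (real s) \<longleftrightarrow>
        radius * sqrt (real s) \<le> \<sigma> * (\<Sum>n=1..t. (Z n \<omega> - true_mean r a) * of_bool (I n \<omega> = a))"
      if "plays (\<lambda>n. I n \<omega>) a t = s" for \<omega> t
    proof -
      have "(\<Sum>n=1..t. (Z n \<omega> - true_mean r a) * of_bool (I n \<omega> = a))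
          = real s * (empirical r a t \<omega> - true_mean r a)"
        using sum_deviation_eq[of "\<lambda>n. I n \<omega>" a t "\<lambda>b n. if r then X b n \<omega> else Y b n \<omega>" "true_mean r a"] that s
        by (simp add: Z empirical_def if_distrib[of "\<lambda>f. f _"] cong: if_cong)
      moreover have "real s = sqrt (real s) * sqrt (real s)" by simp
      ultimately have "\<sigma> * (\<Sum>n=1..t. (Z n \<omega> - true_mean r a) * of_bool (I n \<omega> = a))
          = \<sigma> * (empirical r a t \<omega> - true_mean r a) * sqrt (real s) * sqrt (real s)"
        by (metis mult.assoc mult.commute)
      moreover have "sqrt (real s) > 0" using s by simp
      ultimately show ?thesis by (simp only: mult_le_cancel_right_pos)
    qed
    then show ?thesis unfolding deviation_def plays_def[symmetric] by blast
  qed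
  also have "prob ?E \<le> exp (- (2 * (radius * sqrt (real s))\<^sup>2 / real s))"
  proof (rule predictable_Hoeffding[where F = past])
    fix n :: nat and U :: "'w \<Rightarrow> real" assume "n < T" "U \<in> borel_measurable (past n)"
    then show "indep_var borel U borel (Z (Suc n))"
      unfolding Z_def using a by (intro indep_past) (auto simp: e_def slots_def)
  next
    fix n k :: nat assume "1 \<le> n" "n \<le> k"
    then show "Z n \<in> borel_measurable (past k)"
      unfolding Z_def using a by (intro observable_past_measurable) (auto simp: e_def slots_def)
  next
    fix n k :: nat assume "1 \<le> n" "n \<le> Suc k" "k < T"
    then show "Measurable.pred (past k) (\<lambda>\<omega>. I n \<omega> = a)"
      by (intro play_eq_past_measurable) auto
  next
    fix n :: nat assume "1 \<le> n"
    then show "AE \<omega> in M. Z n \<omega> \<in> {0..1}" "expectation (Z n) = true_mean r a"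
      using reward_bounded[OF a] cost_bounded[OF a] reward_mean[OF a] cost_mean[OF a]
      by (auto simp: Z true_mean_def)
  qed (use s \<sigma> radius_pos subalgebra_past in auto)
  also have "2 * (radius * sqrt (real s))\<^sup>2 / real s = real T / (16 * H)"
    using s by (simp add: power_mult_distrib radius_sq)
  finally show ?thesis .
qed

text \<open>The direction from the true mean towards its threshold: only an error to this side can
  shrink the empirical gap.\<close>

definition pivot_sign :: "bool \<Rightarrow> 'a \<Rightarrow> real" where
  "pivot_sign r a = (if (if r then \<mu>s else C) \<le> true_mean r a then - 1 else 1)"

lemma abs_pivot_sign: "\<bar>pivot_sign r a\<bar> = 1"
  by (simp add: pivot_sign_def)

definition bad :: "'a \<Rightarrow> 'w set" where
  "bad a = (\<Union>s\<in>{1..<T}. deviation 1 (reward_critical a s) a s \<union> deviation (- 1) (reward_critical a s) a s)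
     \<union> (deviation (pivot_sign True a) True a (pivot a) \<union> deviation (pivot_sign False a) False a (pivot a))"

lemma bad_sets: "a \<in> A \<Longrightarrow> bad a \<in> events"
  unfolding bad_def by (intro sets.Un sets.finite_UN deviation_sets) auto

text \<open>The union bound counts \<open>2 * (T - 1)\<close> two-sided events and 2 events at the
  pivot, together \<open>2 * T\<close>.\<close>

lemma prob_bad_le:
  assumes a: "a \<in> A"
  shows "prob (bad a) \<le> 2 * real T * exp (- (real T / (16 * H)))"
proof -
  let ?p = "exp (- (real T / (16 * H)))"
  note dev = deviation_sets[OF a] and le = prob_deviation_le[OF a]
  let ?D = "\<lambda>s. deviation 1 (reward_critical a s) a s \<union> deviation (- 1) (reward_critical a s) a s"
  have "prob (\<Union>s\<in>{1..<T}. ?D s) \<le> (\<Sum>s\<in>{1..<T}. prob (?D s))"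
    using dev by (intro finite_measure_subadditive_finite) auto
  also have "\<dots> \<le> (\<Sum>s\<in>{1..<T}. 2 * ?p)"
  proof (rule sum_mono)
    fix s assume "s \<in> {1..<T}"
    then show "prob (?D s) \<le> 2 * ?p"
      using measure_Un_le[OF dev dev, of 1 "reward_critical a s" s "- 1" "reward_critical a s" s]
        le[of s 1 "reward_critical a s"] le[of s "- 1" "reward_critical a s"] by simp
  qed
  also have "\<dots> = 2 * (real T - 1) * ?p" using T_pos by (simp add: of_nat_diff)
  finally have 1: "prob (\<Union>s\<in>{1..<T}. ?D s) \<le> 2 * (real T - 1) * ?p" .
  have 2: "prob (deviation (pivot_sign True a) True a (pivot a) \<union>
      deviation (pivot_sign False a) False a (pivot a)) \<le> 2 * ?p"
    using measure_Un_le[OF dev dev, of "pivot_sign True a" True "pivot a" "pivot_sign False a" False "pivot a"]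
      le[OF pivot_pos[of a] abs_pivot_sign[of True a], of True] le[OF pivot_pos[of a] abs_pivot_sign[of False a], of False]
    by simp
  have "prob (bad a) \<le> prob (\<Union>s\<in>{1..<T}. ?D s) + prob (deviation (pivot_sign True a) True a (pivot a) \<union>
      deviation (pivot_sign False a) False a (pivot a))"
    unfolding bad_def using dev by (intro measure_Un_le) auto
  also have "\<dots> \<le> 2 * real T * ?p" using 1 2 by (simp add: algebra_simps)
  finally show ?thesis .
qed

lemma output_subset_outside_bad:
  assumes \<omega>: "\<omega> \<in> space M" and good: "\<And>a. a \<in> A \<Longrightarrow> \<omega> \<notin> bad a"
  shows "output_optimal A \<mu>s T (\<lambda>n. I n \<omega>) (\<lambda>a n. X a n \<omega>)
      \<inter> output_feasible A C T (\<lambda>n. I n \<omega>) (\<lambda>a n. Y a n \<omega>)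
    \<subseteq> approx_optimal A \<mu> \<mu>s (- \<epsilon>) \<inter> approx_feasible A c C \<epsilon>"
proof (rule output_subset)
  show "capt_path A \<mu>s C \<epsilon> T (\<lambda>n. I n \<omega>) (\<lambda>a n. X a n \<omega>) (\<lambda>a n. Y a n \<omega>)"
    using run \<omega> by (simp add: capt_run_def)
next
  fix a t assume a: "a \<in> A" and t: "t \<in> {1..T}" and pl: "plays (\<lambda>n. I n \<omega>) a t = pivot a"
  have less: "pivot_sign r a * (empirical r a t \<omega> - true_mean r a) * sqrt (real (pivot a)) \<le> radius" for r
    using good[OF a] \<omega> t pl by (cases r) (force simp: bad_def deviation_def not_le)+
  \<comment> \<open>The gap to the threshold \<open>v\<close> shrinks by at most the signed error of
    the estimate \<open>e\<close> of \<open>m\<close> in the direction of \<open>v\<close>.\<close>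
  have mono: "(\<bar>m - v\<bar> - \<bar>e - v\<bar>) * sqrt (real (pivot a)) \<le> (if v \<le> m then - 1 else 1) * (e - m) * sqrt (real (pivot a))"
    for m v e :: real
    by (intro mult_right_mono) auto
  show "(\<bar>\<mu> a - \<mu>s\<bar> - \<bar>sample_mean (\<lambda>n. I n \<omega>) (\<lambda>a n. X a n \<omega>) a t - \<mu>s\<bar>) * sqrt (real (pivot a)) \<le> radius \<and>
      (\<bar>c a - C\<bar> - \<bar>sample_mean (\<lambda>n. I n \<omega>) (\<lambda>a n. Y a n \<omega>) a t - C\<bar>) * sqrt (real (pivot a)) \<le> radius"
    using order_trans[OF mono less[of True, unfolded pivot_sign_def true_mean_def empirical_def if_True]]
      order_trans[OF mono less[of False, unfolded pivot_sign_def true_mean_def empirical_def if_False]]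
    by blast
next
  fix a t assume a: "a \<in> A" and t: "t \<in> {1..T}" and pl: "plays (\<lambda>n. I n \<omega>) a t \<in> {1..<T}"
  let ?s = "plays (\<lambda>n. I n \<omega>) a t"
  let ?d = "empirical (reward_critical a ?s) a t \<omega> - true_mean (reward_critical a ?s) a"
  have "\<sigma> * ?d * sqrt (real ?s) < radius" if "\<sigma> = 1 \<or> \<sigma> = - 1" for \<sigma>
    using good[OF a] \<omega> t pl that by (force simp: bad_def deviation_def not_le)
  from this[of 1] this[of "- 1"] have "\<bar>?d\<bar> * sqrt (real ?s) \<le> radius"
    by (auto simp: abs_if)
  then show "\<bar>if reward_critical a ?s then sample_mean (\<lambda>n. I n \<omega>) (\<lambda>a n. X a n \<omega>) a t - \<mu> a
      else sample_mean (\<lambda>n. I n \<omega>) (\<lambda>a n. Y a n \<omega>) a t - c a\<bar> * sqrt (real ?s) \<le> radius"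
    by (simp add: empirical_def true_mean_def split: if_splits)
qed

lemma prob_output_subset_ge:
  "prob {\<omega>\<in>space M. output_optimal A \<mu>s T (\<lambda>n. I n \<omega>) (\<lambda>a n. X a n \<omega>)
      \<inter> output_feasible A C T (\<lambda>n. I n \<omega>) (\<lambda>a n. Y a n \<omega>)
    \<subseteq> approx_optimal A \<mu> \<mu>s (- \<epsilon>) \<inter> approx_feasible A c C \<epsilon>}
    \<ge> 1 - 2 * real (card A) * real T * exp (- (real T / (16 * H)))" (is "prob ?G \<ge> _")
proof -
  \<comment> \<open>As a finite conjunction of comparisons between random variables and constants,
    the event is measurable.\<close>
  have "?G = {\<omega>\<in>space M. \<forall>b\<in>A. \<mu>s \<le> empirical True b T \<omega> \<longrightarrow> empirical False b T \<omega> \<le> C \<longrightarrow>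
      b \<in> approx_optimal A \<mu> \<mu>s (- \<epsilon>) \<inter> approx_feasible A c C \<epsilon>}"
    by (auto simp: output_optimal_def output_feasible_def empirical_def)
  moreover have "\<dots> \<in> events"
  proof -
    have [measurable]: "empirical r b T \<in> borel_measurable M" if "b \<in> A" for r b
      using empirical_measurable[OF that] by simp
    show ?thesis using finite_arms by measurable
  qed
  ultimately have G: "?G \<in> events" by simp
  have "space M - ?G \<subseteq> (\<Union>a\<in>A. bad a)"
    using output_subset_outside_bad by blast
  then have "prob (space M - ?G) \<le> prob (\<Union>a\<in>A. bad a)"
    using bad_sets finite_arms by (intro finite_measure_mono) auto
  also have "\<dots> \<le> (\<Sum>a\<in>A. prob (bad a))"
    using bad_sets finite_arms by (intro finite_measure_subadditive_finite) auto
  also have "\<dots> \<le> (\<Sum>a\<in>A. 2 * real T * exp (- (real T / (16 * H))))"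
    using prob_bad_le by (rule sum_mono)
  finally have "prob (space M - ?G) \<le> 2 * real (card A) * real T * exp (- (real T / (16 * H)))"
    by (simp add: mult_ac)
  then show ?thesis using prob_compl[OF G] by simp
qed

end

section \<open>The trivial inclusion and the final bound\<close>

lemma approx_optimal_feasible_empty:
  assumes "finite A" and "\<epsilon> > 0"
  shows "approx_optimal A \<mu> (opt_value A \<mu> c C) \<epsilon> \<inter> approx_feasible A c C (- \<epsilon>) = {}"
proof -
  \<comment> \<open>An arm with slack in its cost is feasible, so the optimum bounds its
    mean.\<close>
  have "\<mu> b \<le> opt_value A \<mu> c C" if "b \<in> A" "c b \<le> C - \<epsilon>" for b
    unfolding opt_value_def using assms that by (intro Max_ge) (auto simp: feasible_set_def)
  then show ?thesis
    using assms(2) by (force simp: approx_optimal_def approx_feasible_def)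
qed

theorem mainTheorem1:
  fixes M :: "'w measure" and A :: "'a set"
    and X Y :: "'a \<Rightarrow> nat \<Rightarrow> 'w \<Rightarrow> real"
    and \<mu> c :: "'a \<Rightarrow> real" and C \<mu>s \<epsilon> :: real
    and T :: nat and I :: "nat \<Rightarrow> 'w \<Rightarrow> 'a"
  assumes "constrained_bandit M A X Y \<mu> c C"
    and "\<And>a t. a \<in> A \<Longrightarrow> t \<ge> 1 \<Longrightarrow> AE r in distr M borel (X a t). r \<in> {0..1}"
    and "\<And>a t. a \<in> A \<Longrightarrow> t \<ge> 1 \<Longrightarrow> AE r in distr M borel (Y a t). r \<in> {0..1}"
    and "\<mu>s = opt_value A \<mu> c C"
    and "\<epsilon> > 0"
    and "T \<ge> 2 * card A"
    and "capt_run M A X Y \<mu>s C \<epsilon> T I"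
  shows "\<P>(\<omega> in M.
      approx_optimal A \<mu> \<mu>s \<epsilon> \<inter> approx_feasible A c C (- \<epsilon>)
        \<subseteq> output_optimal A \<mu>s T (\<lambda>n. I n \<omega>) (\<lambda>a n. X a n \<omega>)
          \<inter> output_feasible A C T (\<lambda>n. I n \<omega>) (\<lambda>a n. Y a n \<omega>)
      \<and> output_optimal A \<mu>s T (\<lambda>n. I n \<omega>) (\<lambda>a n. X a n \<omega>)
          \<inter> output_feasible A C T (\<lambda>n. I n \<omega>) (\<lambda>a n. Y a n \<omega>)
        \<subseteq> approx_optimal A \<mu> \<mu>s (- \<epsilon>) \<inter> approx_feasible A c C \<epsilon>)
    \<ge> 1 - 2 * real (card A) * real T * exp (- (real T / (16 * complexity A \<mu> c \<mu>s C \<epsilon>)))"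
proof -
  interpret constrained_bandit M A X Y \<mu> c C by fact
  interpret bounded_capt_run M A X Y \<mu> c C \<mu>s \<epsilon> T I
  proof unfold_locales
    fix a and t :: nat assume at: "a \<in> A" "t \<ge> 1"
    show "AE \<omega> in M. X a t \<omega> \<in> {0..1}" by (rule AE_distrD[OF reward_rv[OF at] assms(2)[OF at]])
    show "AE \<omega> in M. Y a t \<omega> \<in> {0..1}" by (rule AE_distrD[OF cost_rv[OF at] assms(3)[OF at]])
  qed (use assms finite_arms card_arms in auto)
  \<comment> \<open>With an empty left-hand set the event reduces to the second inclusion.\<close>
  have "approx_optimal A \<mu> \<mu>s \<epsilon> \<inter> approx_feasible A c C (- \<epsilon>) = {}"
    unfolding assms(4) by (rule approx_optimal_feasible_empty[OF finite_arms assms(5)])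
  then show ?thesis using prob_output_subset_ge by simp
qed

end
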